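(* Let $q\ge2$ and let $A:=P\cap S(\gamma)\subset\mathbb{R}^q$ be nonempty, convex and compact with circumradius $R:=R(A)>0$ (the radius of the smallest Euclidean ball containing $A$). Let $(A_k)_{k\ge0}$ be generated by the adaptive-metric algorithm described in the context, with exact scalarizations $(P_{M_k}(v))$ (each returning $z^v$ with $\|z^v\|_{M_k}=d_{M_k}(v,A)$), the farthest-vertex selection rule $v^k\in\arg\max\{\|z^v\|_{M_k}:v\in\operatorname{ext}(A_k)\}$, and symmetric metrics satisfying uniform spectral bounds $mI\preceq M_k\preceq MI$ for all $k\ge0$, with constants $0<m\le M<\infty$. Write $E_k:=\delta_H(A_k,A;\|\cdot\|_2)$ and $\theta:=\sqrt{m/M}$. Then either the algorithm terminates with $A_{\bar k}=A$ after finitely many steps, or for every $\varepsilon>0$ there exists $K\in\mathbb{N}$ such that $$E_k\ \le\ (1+\varepsilon)\,\frac1\theta\,\bar\lambda(A)\,k^{\frac{2}{1-q}}\quad\text{for all }k\ge K,\qquad \bar\lambda(A):=16R\Bigl(\frac{q\pi_q}{\pi_{q-1}}\Bigr)^{\frac{2}{q-1}},$$ where $\pi_q$ is the volume of the Euclidean unit ball in $\mathbb{R}^q$. In particular $E_k=O(k^{2/(1-q)})$.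
   Context: Problem setting. $C\subset\mathbb{R}^q$ is a closed convex cone that is solid (nonempty interior), pointed ($C\cap(-C)=\{0\}$), nontrivial and polyhedral; $C^+=\{w\in\mathbb{R}^q: w^\top y\ge 0\ \forall y\in C\}$, and $y\le_C z$ means $z-y\in C$. $X\subset\mathbb{R}^n$ is nonempty, compact, convex with nonempty interior. $\Gamma:X\to\mathbb{R}^q$ is continuous and $C$-convex: $\Gamma(\lambda x_1+(1-\lambda)x_2)\le_C\lambda\Gamma(x_1)+(1-\lambda)\Gamma(x_2)$ for all $x_1,x_2\in X$, $\lambda\in[0,1]$. $P=\Gamma(X)+C$. Fix $\bar w\in\operatorname{int}C^+$ and $\gamma=\sup_{x\in X}\bar w^\top\Gamma(x)+\alpha$ with $\alpha>0$ large enough that $\Gamma(X)\subset\operatorname{int}S(\gamma)$, where $S(\gamma)=\{y\in\mathbb{R}^q:\bar w^\top y\le\gamma\}$. Scalarization. For symmetric $N\succ0$ let $\|d\|_N=\sqrt{d^\top Nd}$ and $d_N(v,A)=\inf_{y\in A}\|v-y\|_N$. For $v\in\mathbb{R}^q$, $(P_N(v))$ is: minimize $\|z\|_N$ over $x\in X$, $z\in\mathbb{R}^q$ subject to $\Gamma(x)-z-v\le_C0$ and $\bar w^\top(v+z)\le\gamma$. Algorithm. Start from a compact polytope $A_0\supseteq A$. At iteration $k$, with metric $M_k$, solve $(P_{M_k}(v))$ at every vertex $v$ of $A_k$, let $z^v$ be the $z$-part of the optimal solution, and select $v^k$ by the farthest-vertex rule. If $z^{v^k}=0$, terminate (then $A_k=A$).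 Otherwise put $y^k=v^k+z^{v^k}$, $g^k=M_kz^{v^k}/\|z^{v^k}\|_{M_k}$, $H_{k+1}=\{y:(g^k)^\top y\ge(g^k)^\top y^k\}$ (this halfspace contains $A$) and $A_{k+1}=A_k\cap H_{k+1}$. In the paper's concrete instance of the algorithm, for a fixed $\varepsilon_0>0$, $M_0=\varepsilon_0I$ and $M_k=\varepsilon_0I+\frac1k\sum_{i=1}^ku_iu_i^\top$ for $k\ge1$, with $u_i=g^{i-1}/\|g^{i-1}\|_2$; for it one may take $m=\varepsilon_0$, $M=\varepsilon_0+1$. Notation. $\preceq$ is the Loewner order; $\operatorname{ext}(\cdot)$ is the vertex set; $\delta_H(\cdot,\cdot;\|\cdot\|_2)$ is the Euclidean Hausdorff distance. *)

theory Defs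
  imports "HOL-Analysis.Analysis" "HOL-Library.Set_Algebras" "HOL-Library.Landau_Symbols"
begin

definition ordering_cone :: "(real^'q::finite) set \<Rightarrow> bool" where
  "ordering_cone C \<longleftrightarrow>
     closed C \<and> convex_cone C \<and> interior C \<noteq> {} \<and> C \<inter> uminus ` C = {0} \<and>
     C \<noteq> {0} \<and> C \<noteq> UNIV \<and> polyhedron C"

definition dual_cone :: "(real^'q::finite) set \<Rightarrow> (real^'q) set" where
  "dual_cone C = {w. \<forall>y\<in>C. 0 \<le> w \<bullet> y}"

definition cone_le :: "(real^'q::finite) set \<Rightarrow> real^'q \<Rightarrow> real^'q \<Rightarrow> bool" where
  "cone_le C y z \<longleftrightarrow> z - y \<in> C"

definition cone_convex_on ::
    "(real^'q::finite) set \<Rightarrow> (real^'n::finite) set \<Rightarrow> (real^'n \<Rightarrow> real^'q) \<Rightarrow> bool" where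
  "cone_convex_on C X \<Gamma> \<longleftrightarrow>
     (\<forall>x1\<in>X. \<forall>x2\<in>X. \<forall>t\<in>{0..1}.
        cone_le C (\<Gamma> (t *\<^sub>R x1 + (1 - t) *\<^sub>R x2)) (t *\<^sub>R \<Gamma> x1 + (1 - t) *\<^sub>R \<Gamma> x2))"

definition halfspace_S :: "real^'q::finite \<Rightarrow> real \<Rightarrow> (real^'q) set" where
  "halfspace_S w \<gamma> = {y. w \<bullet> y \<le> \<gamma>}"

definition loewner_le :: "real^'q::finite^'q \<Rightarrow> real^'q^'q \<Rightarrow> bool" where
  "loewner_le A B \<longleftrightarrow>
     transpose A = A \<and> transpose B = B \<and> (\<forall>x. 0 \<le> x \<bullet> ((B - A) *v x))"

definition norm_wrt :: "real^'q::finite^'q \<Rightarrow> real^'q \<Rightarrow> real" where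
  "norm_wrt N d = sqrt (d \<bullet> (N *v d))"

definition dist_wrt :: "real^'q::finite^'q \<Rightarrow> real^'q \<Rightarrow> (real^'q) set \<Rightarrow> real" where
  "dist_wrt N v A = (INF y\<in>A. norm_wrt N (v - y))"

definition feasible_P ::
    "(real^'n::finite \<Rightarrow> real^'q::finite) \<Rightarrow> (real^'n) set \<Rightarrow> (real^'q) set \<Rightarrow> real^'q \<Rightarrow> real \<Rightarrow>
     real^'q \<Rightarrow> (real^'n) \<times> (real^'q) \<Rightarrow> bool" where
  "feasible_P \<Gamma> X C w \<gamma> v = (\<lambda>(x, z).
     x \<in> X \<and> cone_le C (\<Gamma> x - z - v) 0 \<and> w \<bullet> (v + z) \<le> \<gamma>)"

definition optimal_P ::
    "(real^'n::finite \<Rightarrow> real^'q::finite) \<Rightarrow> (real^'n) set \<Rightarrow> (real^'q) set \<Rightarrow> real^'q \<Rightarrow> real \<Rightarrow>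
     real^'q^'q \<Rightarrow> real^'q \<Rightarrow> (real^'n) \<times> (real^'q) \<Rightarrow> bool" where
  "optimal_P \<Gamma> X C w \<gamma> N v = is_arg_min (\<lambda>(x, z). norm_wrt N z) (feasible_P \<Gamma> X C w \<gamma> v)"

definition cut_normal :: "real^'q::finite^'q \<Rightarrow> real^'q \<Rightarrow> real^'q" where
  "cut_normal N z = (1 / norm_wrt N z) *\<^sub>R (N *v z)"

definition cut_halfspace :: "real^'q::finite^'q \<Rightarrow> real^'q \<Rightarrow> real^'q \<Rightarrow> (real^'q) set" where
  "cut_halfspace N v z = {y. cut_normal N z \<bullet> y \<ge> cut_normal N z \<bullet> (v + z)}"

(* A run is given by total sequences As, vs, zs, where zs k u is the z-part of the solution
   computed at the vertex u of As k and vs k is the selected vertex. Entries that lie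
   beyond the iteration at which the algorithm stops are unconstrained. *)

definition reached :: "(nat \<Rightarrow> real^'q::finite) \<Rightarrow> (nat \<Rightarrow> real^'q \<Rightarrow> real^'q) \<Rightarrow> nat \<Rightarrow> bool" where
  "reached vs zs k \<longleftrightarrow> (\<forall>j<k. zs j (vs j) \<noteq> 0)"

definition terminates_at ::
    "(nat \<Rightarrow> real^'q::finite) \<Rightarrow> (nat \<Rightarrow> real^'q \<Rightarrow> real^'q) \<Rightarrow> nat \<Rightarrow> bool" where
  "terminates_at vs zs k \<longleftrightarrow> reached vs zs k \<and> zs k (vs k) = 0"

definition adaptive_metric_run ::
    "(real^'n::finite \<Rightarrow> real^'q::finite) \<Rightarrow> (real^'n) set \<Rightarrow> (real^'q) set \<Rightarrow> real^'q \<Rightarrow> real \<Rightarrow>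
     (nat \<Rightarrow> real^'q^'q) \<Rightarrow> (nat \<Rightarrow> (real^'q) set) \<Rightarrow> (nat \<Rightarrow> real^'q) \<Rightarrow>
     (nat \<Rightarrow> real^'q \<Rightarrow> real^'q) \<Rightarrow> bool" where
  "adaptive_metric_run \<Gamma> X C w \<gamma> Ms As vs zs \<longleftrightarrow>
     polytope (As 0) \<and> (\<Gamma> ` X + C) \<inter> halfspace_S w \<gamma> \<subseteq> As 0 \<and>
     (\<forall>k. reached vs zs k \<longrightarrow>
        (\<forall>u. u extreme_point_of As k \<longrightarrow> (\<exists>x. optimal_P \<Gamma> X C w \<gamma> (Ms k) u (x, zs k u))) \<and>
        is_arg_max (\<lambda>u. norm_wrt (Ms k) (zs k u)) (\<lambda>u. u extreme_point_of As k) (vs k) \<and>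
        (zs k (vs k) \<noteq> 0 \<longrightarrow>
           As (Suc k) = As k \<inter> cut_halfspace (Ms k) (vs k) (zs k (vs k))))"

(* The conditionally complete suprema and infima below are the mathematical ones for
   nonempty bounded sets. *)

definition hausdorff_dist :: "'a::metric_space set \<Rightarrow> 'a set \<Rightarrow> real" where
  "hausdorff_dist S T = max (SUP x\<in>S. infdist x T) (SUP y\<in>T. infdist y S)"

definition circumradius :: "'a::metric_space set \<Rightarrow> real" where
  "circumradius S = Inf {r. 0 \<le> r \<and> (\<exists>c. S \<subseteq> cball c r)}"

definition lambda_bar :: "(real^'q::finite) set \<Rightarrow> real" where
  "lambda_bar A =
     16 * circumradius A *
     (real CARD('q) * unit_ball_vol (real CARD('q)) / unit_ball_vol (real CARD('q) - 1))
       powr (2 / (real CARD('q) - 1))"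

end

theory Submission
  imports Defs
begin

text \<open>Every iteration produces a hyperplane that supports \<open>A\<close> at \<open>y\<^sub>i\<close>, with outward unit normal
  \<open>u\<^sub>i\<close>, and cuts off \<open>v\<^sub>i\<close> at Euclidean depth at least \<open>\<theta> E\<^sub>i\<close>: if \<open>n\<^sub>i\<close> is
  the largest \<open>M\<^sub>i\<close>-distance of a vertex to \<open>A\<close>, then \<open>E\<^sub>i \<le> n\<^sub>i / sqrt m\<close>, while the depth is at least
  \<open>n\<^sub>i / sqrt M\<close>. Let \<open>A\<close> lie in a ball of radius \<open>R\<close>. For \<open>j < i\<close> the vertex
  \<open>v\<^sub>i\<close> satisfies the \<open>j\<close>-th cut, so \<open>(y\<^sub>i - y\<^sub>j) \<bullet> (u\<^sub>i - u\<^sub>j)\<close> is at least about \<open>\<theta> E\<^sub>i\<close> when the normals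
  are close, and hence the points \<open>y\<^sub>i + R u\<^sub>i\<close> have mutual squared distance at least about
  \<open>2 R \<theta> E\<^sub>k\<close> for \<open>i, j \<le> k\<close>. Pushing them outward along their normals to the concentric sphere of
  radius \<open>2 R\<close> does not decrease distances, and a volume count in a thin shell around that sphere
  bounds \<open>k\<close>.\<close>

section \<open>Packing points on a sphere\<close>

text \<open>The balls of radius r about the points are disjoint and lie in the shell between the
  spheres of radii L - r and L + r about c. Comparing volumes, the unit ball volume cancels.\<close>

lemma sphere_packing_count:
  fixes s :: "'i \<Rightarrow> 'a::euclidean_space"
  assumes I: "finite I"
    and on_sphere: "\<And>i. i \<in> I \<Longrightarrow> dist c (s i) = L"
    and apart: "\<And>i j. \<lbrakk>i \<in> I; j \<in> I; i \<noteq> j\<rbrakk> \<Longrightarrow> 2 * r \<le> dist (s i) (s j)"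
    and r: "0 \<le> r" "r \<le> L"
  shows "real (card I) * r ^ DIM('a) \<le> (L + r) ^ DIM('a) - (L - r) ^ DIM('a)"
proof -
  let ?n = "DIM('a)"
  let ?V = "unit_ball_vol (real ?n)"
  let ?U = "\<Union>i\<in>I. ball (s i) r"
  have disj: "pairwise (\<lambda>i j. disjnt (ball (s i) r) (ball (s j) r)) I"
    using apart by (auto simp: pairwise_def disjnt_def intro!: disjoint_ballI)
  have "measure lebesgue ?U = (\<Sum>i\<in>I. measure lebesgue (ball (s i) r))"
    by (rule measure_UNION'[OF I _ disj]) auto
  also have "\<dots> = real (card I) * (?V * r ^ ?n)"
    using r by (simp add: content_ball)
  finally have U: "measure lebesgue ?U = real (card I) * (?V * r ^ ?n)" .
  have disj2: "disjnt (ball c (L - r)) ?U"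
    unfolding disjnt_def
  proof (safe; simp)
    fix x i assume i: "i \<in> I" and x: "dist c x < L - r" "dist (s i) x < r"
    have "dist c (s i) \<le> dist c x + dist (s i) x"
      by (metis dist_commute dist_triangle)
    then show False using x on_sphere[OF i] by simp
  qed
  have Um: "?U \<in> lmeasurable"
    using I by (intro fmeasurable.finite_UN) auto
  have "measure lebesgue (ball c (L - r)) + measure lebesgue ?U
      = measure lebesgue (ball c (L - r) \<union> ?U)"
    using disj2 fmeasurableD2[OF Um] fmeasurableD2[OF lmeasurable_ball]
    by (intro measure_Union[symmetric] fmeasurableD[OF Um]) (simp_all add: disjnt_def)
  also have "\<dots> \<le> measure lebesgue (cball c (L + r))"
  proof (rule measure_mono_fmeasurable)
    show "ball c (L - r) \<union> ?U \<subseteq> cball c (L + r)"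
    proof
      fix x assume "x \<in> ball c (L - r) \<union> ?U"
      then consider "dist c x < L - r" | i where "i \<in> I" "dist (s i) x < r" by auto
      then show "x \<in> cball c (L + r)"
      proof cases
        case 2
        then show ?thesis
          using dist_triangle[of c x "s i"] on_sphere[of i] by simp
      qed (use r in simp)
    qed
    show "ball c (L - r) \<union> ?U \<in> sets lebesgue"
      using Um by auto
  qed auto
  finally have "?V * (L - r) ^ ?n + real (card I) * (?V * r ^ ?n) \<le> ?V * (L + r) ^ ?n"
    using r U by (simp add: content_ball content_cball)
  then have "?V * (real (card I) * r ^ ?n) \<le> ?V * ((L + r) ^ ?n - (L - r) ^ ?n)"
    by (simp add: algebra_simps)
  then show ?thesis by simp
qed

text \<open>The bases differ by 2 * x, so the difference of powers carries a factor x. Cancelling it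
  lowers the exponent in the packing count by one.\<close>

lemma power_Suc_diff_le:
  fixes x :: real
  assumes "0 \<le> x" "x \<le> 1"
  shows "(1 + x) ^ Suc d - (1 - x) ^ Suc d \<le> 2 * real (Suc d) * x * (1 + x) ^ d"
proof (induction d)
  case (Suc d)
  have "(1 + x) ^ Suc (Suc d) - (1 - x) ^ Suc (Suc d)
      = (1 + x) * ((1 + x) ^ Suc d - (1 - x) ^ Suc d) + 2 * x * (1 - x) ^ Suc d"
    by (simp add: algebra_simps)
  also have "\<dots> \<le> (1 + x) * (2 * real (Suc d) * x * (1 + x) ^ d) + 2 * x * (1 + x) ^ Suc d"
    using assms by (intro add_mono mult_left_mono Suc power_mono) auto
  also have "\<dots> = 2 * real (Suc (Suc d)) * x * (1 + x) ^ Suc d"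
    by (simp add: algebra_simps)
  finally show ?case .
qed simp

text \<open>The shell count with balls of radius x * L. The exponent that is left is the dimension
  of the sphere, the source of the exponent in the final rate.\<close>

lemma sphere_packing_count_le:
  fixes s :: "'i \<Rightarrow> 'a::euclidean_space"
  assumes I: "finite I"
    and on_sphere: "\<And>i. i \<in> I \<Longrightarrow> dist c (s i) = L"
    and apart: "\<And>i j. \<lbrakk>i \<in> I; j \<in> I; i \<noteq> j\<rbrakk> \<Longrightarrow> 2 * (x * L) \<le> dist (s i) (s j)"
    and x: "0 < x" "x \<le> 1" and L: "0 < L"
  shows "real (card I) * x ^ (DIM('a) - 1) \<le> 2 * real DIM('a) * (1 + x) ^ (DIM('a) - 1)"
proof -
  obtain d where d: "DIM('a) = Suc d"
    using DIM_positive[where 'a='a] gr0_implies_Suc by blast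
  have "real (card I) * (x * L) ^ Suc d \<le> (L + x * L) ^ Suc d - (L - x * L) ^ Suc d"
    using sphere_packing_count[OF I on_sphere, where r = "x * L"] apart x L
    unfolding d by (simp add: mult_le_cancel_right1)
  also have "(L + x * L) ^ Suc d = L ^ Suc d * (1 + x) ^ Suc d"
    by (metis distrib_left mult.commute mult.right_neutral power_mult_distrib)
  also have "(L - x * L) ^ Suc d = L ^ Suc d * (1 - x) ^ Suc d"
    by (metis right_diff_distrib mult.commute mult.right_neutral power_mult_distrib)
  finally have "L ^ Suc d * (real (card I) * x ^ Suc d) \<le> L ^ Suc d * ((1 + x) ^ Suc d - (1 - x) ^ Suc d)"
    by (simp only: power_mult_distrib right_diff_distrib mult_ac)
  then have "real (card I) * x ^ Suc d \<le> (1 + x) ^ Suc d - (1 - x) ^ Suc d"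
    using L by (simp only: mult_le_cancel_left_pos zero_less_power)
  also have "\<dots> \<le> 2 * real (Suc d) * x * (1 + x) ^ d"
    using x by (intro power_Suc_diff_le) auto
  finally have "x * (real (card I) * x ^ d) \<le> x * (2 * real (Suc d) * (1 + x) ^ d)"
    by (simp add: mult_ac)
  then show ?thesis
    using x by (simp only: mult_le_cancel_left_pos d diff_Suc_1)
qed

section \<open>Separation of cutting points\<close>

text \<open>The distance to c is at most 2 * R at parameter R and at least 2 * R at parameter 3 * R,
  so the intermediate value theorem applies. The bound R \<le> t is what
  \<open>dist_outward_mono\<close> asks for.\<close>

lemma normal_ray_meets_sphere:
  fixes y u c :: "'a::real_inner"
  assumes "norm u = 1" "dist c y \<le> R"
  obtains t where "R \<le> t" "dist c (y + t *\<^sub>R u) = 2 * R"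
proof -
  let ?f = "\<lambda>t. dist c (y + t *\<^sub>R u)"
  have R: "0 \<le> R" using assms(2) zero_le_dist order_trans by blast
  have low: "?f R \<le> 2 * R"
    using dist_triangle[of c "y + R *\<^sub>R u" y] assms R by (simp add: dist_norm)
  have "3 * R = dist y (y + (3 * R) *\<^sub>R u)"
    using assms R by (simp add: dist_norm)
  also have "\<dots> \<le> dist c y + ?f (3 * R)"
    by (metis dist_commute dist_triangle)
  finally have up: "2 * R \<le> ?f (3 * R)"
    using assms(2) by simp
  have "\<exists>t\<ge>R. t \<le> 3 * R \<and> ?f t = 2 * R"
    using R by (intro IVT') (auto intro!: continuous_intros low up)
  then show ?thesis using that by blast
qed

text \<open>Moving outward along the normals increases distances, since the nearest-point map onto
  a convex set is nonexpansive.\<close>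

lemma dist_outward_mono:
  fixes y y' u u' :: "'a::real_inner"
  assumes u: "norm u = 1" "norm u' = 1"
    and supp: "u \<bullet> (y' - y) \<le> 0" "u' \<bullet> (y - y') \<le> 0"
    and t: "r \<le> t" "r \<le> t'" "0 \<le> r"
  shows "dist (y + r *\<^sub>R u) (y' + r *\<^sub>R u') \<le> dist (y + t *\<^sub>R u) (y' + t' *\<^sub>R u')"
proof -
  define p where "p = (y + r *\<^sub>R u) - (y' + r *\<^sub>R u')"
  define s where "s = (y + t *\<^sub>R u) - (y' + t' *\<^sub>R u')"
  have uu: "u \<bullet> u = 1" "u' \<bullet> u' = 1" using u by (simp_all add: dot_square_norm)
  have le1: "u \<bullet> u' \<le> 1" using norm_cauchy_schwarz[of u u'] u by simp
  \<comment> \<open>Support gives u and - u' nonnegative inner product with p, hence also the extra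
    displacement s - p. So p \<bullet> p \<le> s \<bullet> p, and Cauchy-Schwarz finishes.\<close>
  have up: "0 \<le> u \<bullet> p"
  proof -
    have "u \<bullet> p = - (u \<bullet> (y' - y)) + r * (1 - u \<bullet> u')"
      by (simp add: p_def inner_diff_right inner_add_right uu algebra_simps)
    moreover have "0 \<le> r * (1 - u \<bullet> u')" using le1 t by simp
    ultimately show ?thesis using supp by linarith
  qed
  have u'p: "u' \<bullet> p \<le> 0"
  proof -
    have "u' \<bullet> p = u' \<bullet> (y - y') - r * (1 - u \<bullet> u')"
      by (simp add: p_def inner_diff_right inner_add_right uu inner_commute algebra_simps)
    moreover have "0 \<le> r * (1 - u \<bullet> u')" using le1 t by simp
    ultimately show ?thesis using supp by linarith
  qed
  have "s = p + (t - r) *\<^sub>R u - (t' - r) *\<^sub>R u'"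
    by (simp add: s_def p_def algebra_simps)
  then have "s \<bullet> p = p \<bullet> p + (t - r) * (u \<bullet> p) - (t' - r) * (u' \<bullet> p)"
    by (simp add: inner_add_left inner_diff_left)
  moreover have "0 \<le> (t - r) * (u \<bullet> p)" "0 \<le> - ((t' - r) * (u' \<bullet> p))"
    using up u'p t by (auto simp: mult_nonneg_nonpos)
  ultimately have "p \<bullet> p \<le> s \<bullet> p" by linarith
  also have "\<dots> \<le> norm s * norm p" by (rule norm_cauchy_schwarz)
  finally have "norm p * norm p \<le> norm s * norm p" by (simp add: dot_square_norm power2_eq_square)
  then have "norm p \<le> norm s"
    by (metis mult_le_cancel_right norm_ge_zero norm_zero zero_less_norm_iff)
  then show ?thesis by (simp add: p_def s_def dist_norm)
qed

text \<open>The squared distance expands into three nonnegative terms. Far apart normals make the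
  last one large. For close normals, v lies deep beyond the cut at y' but not beyond the cut at y,
  which makes the middle term large.\<close>

lemma cut_separation:
  fixes y y' v u u' :: "'a::real_inner"
  assumes supp: "u \<bullet> (y' - y) \<le> 0" "u' \<bullet> (y - y') \<le> 0"
    and old: "u \<bullet> (v - y) \<le> 0"
    and obliq: "\<theta> * norm (v - y') \<le> u' \<bullet> (v - y')"
    and D: "D \<le> u' \<bullet> (v - y')" "0 \<le> D"
    and \<theta>: "0 < \<theta>" and s: "0 \<le> s" "s \<le> 1" and r: "0 \<le> r"
  shows "min ((r * (s * \<theta>))\<^sup>2) (2 * r * (D * (1 - s))) \<le> (dist (y + r *\<^sub>R u) (y' + r *\<^sub>R u'))\<^sup>2"
proof -
  define a where "a = u' \<bullet> (y' - y) + u \<bullet> (y - y')"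
  have "a = (y - y') \<bullet> (u - u')"
    by (simp add: a_def inner_diff_left inner_diff_right inner_commute)
  moreover have "(norm (g + r *\<^sub>R h))\<^sup>2 = (norm g)\<^sup>2 + 2 * r * (g \<bullet> h) + (r * norm h)\<^sup>2"
    for g h :: 'a
    unfolding power_mult_distrib power2_norm_eq_inner
    by (simp add: inner_add_left inner_add_right inner_commute power2_eq_square algebra_simps)
  ultimately have "(norm ((y - y') + r *\<^sub>R (u - u')))\<^sup>2
      = (norm (y - y'))\<^sup>2 + 2 * r * a + (r * norm (u - u'))\<^sup>2"
    by simp
  moreover have "dist (y + r *\<^sub>R u) (y' + r *\<^sub>R u') = norm ((y - y') + r *\<^sub>R (u - u'))"
    by (simp add: dist_norm algebra_simps)
  ultimately have eq: "(dist (y + r *\<^sub>R u) (y' + r *\<^sub>R u'))\<^sup>2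
      = (norm (y - y'))\<^sup>2 + 2 * r * a + (r * norm (u - u'))\<^sup>2"
    by simp
  have a0: "0 \<le> a"
    using supp by (simp add: a_def inner_diff_right)
  show ?thesis
  proof (cases "s * \<theta> \<le> norm (u - u')")
    case True
    then have "(r * (s * \<theta>))\<^sup>2 \<le> (r * norm (u - u'))\<^sup>2"
      using \<theta> s r by (intro power_mono mult_left_mono) auto
    then show ?thesis
      unfolding eq using a0 r by (smt (verit) mult_nonneg_nonneg zero_le_power2)
  next
    case False
    define \<delta> where "\<delta> = u' \<bullet> (v - y')"
    \<comment> \<open>Replacing u' by the close normal u loses at most the fraction s of the depth
      of v, by \<open>obliq\<close>. As v satisfies the cut at y, the point y lies at least as far
      in direction u.\<close>
    have "(u' - u) \<bullet> (v - y') \<le> norm (u - u') * norm (v - y')"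
      by (metis norm_cauchy_schwarz norm_minus_commute)
    also have "\<dots> \<le> (s * \<theta>) * norm (v - y')"
      using False by (intro mult_right_mono) auto
    also have "\<dots> \<le> s * \<delta>"
      using obliq s by (simp add: \<delta>_def mult.assoc mult_left_mono)
    finally have "\<delta> - s * \<delta> \<le> u \<bullet> (v - y')"
      by (simp add: \<delta>_def inner_diff_left)
    also have "\<dots> \<le> u \<bullet> (y - y')"
      using old by (simp add: inner_diff_right)
    finally have "\<delta> * (1 - s) \<le> a"
      using supp(2) by (simp add: a_def inner_diff_right algebra_simps)
    moreover have "D * (1 - s) \<le> \<delta> * (1 - s)"
      using D s by (intro mult_right_mono) (auto simp: \<delta>_def)
    ultimately have "2 * r * (D * (1 - s)) \<le> 2 * r * a"
      using r by (intro mult_left_mono) auto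
    then show ?thesis
      unfolding eq by (smt (verit) zero_le_power2)
  qed
qed

section \<open>Convergence rate of deep supporting cuts\<close>

text \<open>Because \<open>deep\<close> measures every cut i \<le> k against E k, all points up to
  index k share one separation and are counted together. The parameter s divides close from far
  normals and may later tend to 0.\<close>

lemma cutting_rate:
  fixes u y v :: "nat \<Rightarrow> 'a::euclidean_space" and E :: "nat \<Rightarrow> real"
  assumes dim: "DIM('a) \<ge> 2"
    and AR: "A \<subseteq> cball c R" and R: "0 < R"
    and u: "\<And>i. norm (u i) = 1"
    and y: "\<And>i. y i \<in> A"
    and supp: "\<And>i a. a \<in> A \<Longrightarrow> u i \<bullet> (a - y i) \<le> 0"
    and old: "\<And>i j. j < i \<Longrightarrow> u j \<bullet> (v i - y j) \<le> 0"
    and obliq: "\<And>i. \<theta> * norm (v i - y i) \<le> u i \<bullet> (v i - y i)"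
    and deep: "\<And>i k. i \<le> k \<Longrightarrow> \<theta> * E k \<le> u i \<bullet> (v i - y i)"
    and E: "\<And>k. 0 \<le> E k"
    and \<theta>: "0 < \<theta>" "\<theta> \<le> 1" and s: "0 < s" "s < 1"
  shows "\<exists>K. \<forall>k\<ge>K. E k \<le> 8 * R * (1 + s)\<^sup>2 / (\<theta> * (1 - s)) *
           (2 * real DIM('a) / real k) powr (2 / (real DIM('a) - 1))"
proof -
  define q where "q = real DIM('a)"
  define d where "d = DIM('a) - 1"
  have d: "d \<ge> 1" "real d = q - 1" "q \<ge> 2"
    using dim by (auto simp: d_def q_def)
  have "\<exists>t. R \<le> t \<and> dist c (y i + t *\<^sub>R u i) = 2 * R" for i
    using normal_ray_meets_sphere[OF u, of c "y i" R i] y AR by (metis mem_cball subsetD)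
  then obtain t where t: "\<And>i. R \<le> t i" "\<And>i. dist c (y i + t i *\<^sub>R u i) = 2 * R"
    by metis
  define p where "p i = y i + t i *\<^sub>R u i" for i
  \<comment> \<open>\<open>rho2\<close> is the squared separation given by
    \<open>cut_separation\<close> for D = \<theta> * E k. Half of its root, relative to the sphere
    radius 2 * R, is \<open>x k\<close>.\<close>
  define rho2 where "rho2 k = min ((R * (s * \<theta>))\<^sup>2) (2 * R * (\<theta> * E k * (1 - s)))" for k
  define x where "x k = sqrt (rho2 k) / (4 * R)" for k
  have rho2_0: "0 \<le> rho2 k" for k
    using E R \<theta> s by (simp add: rho2_def)
  have apart_less: "2 * (x k * (2 * R)) \<le> dist (p j) (p i)" if "j < i" "i \<le> k" for i j k
  proof -
    \<comment> \<open>The earlier cut j is the one that \<open>v i\<close> satisfies, the later cut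
      i the one that removes it.\<close>
    have "rho2 k \<le> (dist (y j + R *\<^sub>R u j) (y i + R *\<^sub>R u i))\<^sup>2"
      unfolding rho2_def
      by (rule cut_separation[OF _ _ old[OF that(1)] obliq deep[OF that(2)]])
         (use supp y E \<theta> s R in auto)
    then have "sqrt (rho2 k) \<le> dist (y j + R *\<^sub>R u j) (y i + R *\<^sub>R u i)"
      by (simp add: real_le_lsqrt)
    also have "\<dots> \<le> dist (p j) (p i)"
      unfolding p_def by (rule dist_outward_mono) (use u supp y t R in auto)
    finally show ?thesis using R by (simp add: x_def)
  qed
  have apart: "2 * (x k * (2 * R)) \<le> dist (p j) (p i)" if "i \<le> k" "j \<le> k" "i \<noteq> j" for i j k
    using apart_less[of i j k] apart_less[of j i k] that
    by (metis dist_commute linorder_neqE_nat)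
  have x_le: "x k \<le> s * \<theta> / 4" for k
  proof -
    have "sqrt (rho2 k) \<le> R * (s * \<theta>)"
      using R s \<theta> by (intro real_le_lsqrt) (auto simp: rho2_def)
    then show ?thesis using R by (simp add: x_def field_simps)
  qed
  have x0: "0 \<le> x k" for k
    using R rho2_0 by (simp add: x_def)
  have x1: "x k \<le> s" for k
  proof -
    have "s * \<theta> \<le> s" using s \<theta> by (simp add: mult_left_le)
    moreover have "0 \<le> s * \<theta>" using s \<theta> by simp
    ultimately show ?thesis using x_le[of k] by linarith
  qed
  have count: "real k * x k ^ d \<le> 2 * q * (1 + x k) ^ d" for k
  proof (cases "x k = 0")
    case True
    then show ?thesis using d by (simp add: power_0_left)
  next
    case False
    then have "0 < x k" using x0[of k] by simp
    then have "real (card {..k}) * x k ^ d \<le> 2 * q * (1 + x k) ^ d"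
      unfolding d_def q_def
      by (intro sphere_packing_count_le[of "{..k}" c p "2 * R"])
         (use apart x1[of k] s R t in \<open>auto simp: p_def\<close>)
    moreover have "real k * x k ^ d \<le> real (card {..k}) * x k ^ d"
      using x0 by (intro mult_right_mono) auto
    ultimately show ?thesis by linarith
  qed
  \<comment> \<open>If the far-normal term were the minimum in \<open>rho2 k\<close>, then
    \<open>x k\<close> would be the constant s * \<theta> / 4 and the count would bound k. From K
    on, the minimum is therefore the term linear in E k.\<close>
  obtain K where K: "2 * q * 2 ^ d / (s * \<theta> / 4) ^ d < real K"
    using reals_Archimedean2 by blast
  have small: "x k < s * \<theta> / 4" if "K \<le> k" for k
  proof (rule ccontr)
    assume "\<not> x k < s * \<theta> / 4"
    then have x_eq: "x k = s * \<theta> / 4" using x_le[of k] by simp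
    have pos: "0 < (s * \<theta> / 4) ^ d" using s \<theta> by simp
    have "2 * q * (1 + x k) ^ d \<le> 2 * q * 2 ^ d"
      using d x0[of k] x1[of k] s by (intro mult_left_mono power_mono) auto
    also have "\<dots> < real K * (s * \<theta> / 4) ^ d"
      using K pos by (simp only: pos_divide_less_eq)
    also have "\<dots> \<le> real k * x k ^ d"
      using that pos by (simp add: x_eq mult_right_mono)
    finally show False using count[of k] by simp
  qed
  have "E k \<le> 8 * R * (1 + s)\<^sup>2 / (\<theta> * (1 - s)) * (2 * q / real k) powr (2 / (q - 1))"
    if k: "max K 1 \<le> k" for k
  proof -
    have "rho2 k \<noteq> (R * (s * \<theta>))\<^sup>2"
    proof
      assume "rho2 k = (R * (s * \<theta>))\<^sup>2"
      then have "sqrt (rho2 k) = R * (s * \<theta>)" using R s \<theta> by (simp only: real_sqrt_abs) simp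
      then have "x k = s * \<theta> / 4" using R by (simp add: x_def)
      then show False using small[of k] k by simp
    qed
    then have rho2_eq: "rho2 k = 2 * R * (\<theta> * E k * (1 - s))"
      by (auto simp: rho2_def min_def split: if_splits)
    have "(x k)\<^sup>2 = rho2 k / (16 * R\<^sup>2)"
      using rho2_0 by (simp add: x_def power_divide power_mult_distrib)
    \<comment> \<open>The constant 8 * R is the 16 R^2 from \<open>x k\<close> over the 2 * R from
      \<open>rho2\<close>.\<close>
    then have E_eq: "E k = 8 * R / (\<theta> * (1 - s)) * (x k)\<^sup>2"
      using R \<theta> s rho2_eq by (simp add: power2_eq_square)
    define b where "b = 2 * q / real k"
    have "0 < 2 * q" "0 < real k" using d k by auto
    then have b0: "0 < b" unfolding b_def by (rule divide_pos_pos)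
    have "(x k / (1 + x k)) ^ d \<le> b"
      using count[of k] k x0[of k] by (simp add: b_def power_divide field_simps)
    also have "b = (b powr (1 / real d)) ^ d"
    proof -
      have "(b powr (1 / real d)) ^ d = (b powr (1 / real d)) powr real d"
        using b0 by (intro powr_realpow[symmetric]) simp
      also have "\<dots> = b" using b0 d(1) by (simp add: powr_powr)
      finally show ?thesis by (rule sym)
    qed
    finally have "x k / (1 + x k) \<le> b powr (1 / real d)"
      by (rule power_mono_iff[THEN iffD1, rotated 3]) (use x0[of k] d(1) in simp_all)
    then have "x k \<le> (1 + x k) * b powr (1 / real d)"
      using x0[of k] by (simp add: field_simps)
    also have "\<dots> \<le> (1 + s) * b powr (1 / real d)"
      using x1[of k] by (intro mult_right_mono) auto
    finally have "(x k)\<^sup>2 \<le> ((1 + s) * b powr (1 / real d))\<^sup>2"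
      using x0 by (intro power_mono) auto
    also have "\<dots> = (1 + s)\<^sup>2 * b powr (2 / (q - 1))"
    proof -
      have "1 / real d + 1 / real d = 2 / (q - 1)" using d(2) by simp
      then have "(b powr (1 / real d))\<^sup>2 = b powr (2 / (q - 1))"
        unfolding power2_eq_square powr_add[symmetric] by (rule arg_cong)
      then show ?thesis by (simp only: power_mult_distrib)
    qed
    finally have "E k \<le> 8 * R / (\<theta> * (1 - s)) * ((1 + s)\<^sup>2 * b powr (2 / (q - 1)))"
      unfolding E_eq using R \<theta> s by (intro mult_left_mono) auto
    then show ?thesis by (simp add: b_def)
  qed
  then show ?thesis unfolding q_def by blast
qed

section \<open>Comparison of constants\<close>

text \<open>The functional equation of Gamma, prepared for an induction over dimensions of equal
  parity.\<close>

lemma unit_ball_vol_add_2: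
  assumes "0 \<le> x"
  shows "unit_ball_vol (x + 2) = 2 * pi / (x + 2) * unit_ball_vol x"
proof -
  have "Gamma ((x + 2) / 2 + 1) = (x / 2 + 1) * Gamma (x / 2 + 1)"
  proof -
    have "x / 2 + 1 \<notin> \<int>\<^sub>\<le>\<^sub>0" using assms by (auto elim!: nonpos_Ints_cases)
    then show ?thesis
      using Gamma_plus1[of "x / 2 + 1"] by (simp add: add_divide_distrib add_ac)
  qed
  moreover have "pi powr ((x + 2) / 2) = pi * pi powr (x / 2)"
    by (simp add: add_divide_distrib powr_add)
  moreover have "Gamma (x / 2 + 1) > 0" using assms by (intro Gamma_real_pos) simp
  ultimately show ?thesis using assms
    by (simp only: unit_ball_vol_def) (simp add: divide_simps distrib_left)
qed

text \<open>Induction in steps of two from dimensions 2 and 3: the power of two gains a factor 4,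
  while the squared ratio is multiplied by at least 1 / 2. This is the square of the inequality on
  which \<open>packing_constant_le\<close> rests.\<close>

lemma unit_ball_vol_ratio_ge:
  "4 \<le> 2 ^ Suc n * (unit_ball_vol (real n + 2) / unit_ball_vol (real n + 1))\<^sup>2"
proof (induction n rule: less_induct)
  case (less n)
  let ?k = "\<lambda>x. unit_ball_vol (x + 2) / unit_ball_vol (x + 1)"
  consider "n = 0" | "n = 1" | k where "n = k + 2"
    by (metis One_nat_def add_2_eq_Suc' not0_implies_Suc)
  then show ?case
  proof cases
    case 1
    have "3\<^sup>2 \<le> pi\<^sup>2" using pi_gt3 by (intro power_mono) auto
    then show ?thesis using 1 by (simp add: unit_ball_vol_2 power_divide)
  next
    case 2
    then show ?thesis by (simp add: unit_ball_vol_2 unit_ball_vol_3 power_divide)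
  next
    case 3
    have "?k (real n) = unit_ball_vol ((real k + 2) + 2) / unit_ball_vol ((real k + 1) + 2)"
      by (simp add: 3 add_ac)
    also have "\<dots> = (real k + 3) / (real k + 4) * ?k (real k)"
      by (subst (1 2) unit_ball_vol_add_2) (simp_all add: add_ac)
    finally have eq: "?k (real n) = (real k + 3) / (real k + 4) * ?k (real k)" .
    have "1 / 2 \<le> ((real k + 3) / (real k + 4))\<^sup>2"
      by (simp add: power_divide divide_simps) (simp add: power2_eq_square algebra_simps)
    then have "1 \<le> 4 * ((real k + 3) / (real k + 4))\<^sup>2" by simp
    have "4 \<le> 2 ^ Suc k * (?k (real k))\<^sup>2"
      using less[of k] 3 by simp
    also have "\<dots> \<le> (4 * ((real k + 3) / (real k + 4))\<^sup>2) * (2 ^ Suc k * (?k (real k))\<^sup>2)"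
      by (rule mult_right_mono[OF \<open>1 \<le> 4 * _\<close>, of "2 ^ Suc k * (?k (real k))\<^sup>2", simplified mult_1])
         simp
    also have "\<dots> = 2 ^ Suc n * (?k (real n))\<^sup>2"
      unfolding eq by (simp only: 3 power_mult_distrib) simp
    finally show ?thesis .
  qed
qed

text \<open>The sharp separation of the cutting points gains a factor \<open>2\<close> over \<open>lambda_bar\<close>, and this
  covers the loss from measuring a spherical shell instead of caps on the sphere.\<close>

lemma packing_constant_le:
  fixes n :: nat
  assumes "n \<ge> 2"
  shows "8 * (2 * real n) powr (2 / (real n - 1)) \<le>
    16 * (real n * unit_ball_vol (real n) / unit_ball_vol (real n - 1)) powr (2 / (real n - 1))"
proof -
  obtain m where m: "n = m + 2" using assms by (metis add.commute le_Suc_ex)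
  define d where "d = real n - 1"
  define \<kappa> where "\<kappa> = unit_ball_vol (real n) / unit_ball_vol (real n - 1)"
  have d: "d > 0" "d = real (Suc m)" using assms by (auto simp: d_def m)
  have \<kappa>0: "0 < \<kappa>" unfolding \<kappa>_def using assms by (intro divide_pos_pos) auto
  have "(2::real)\<^sup>2 \<le> (2 powr (d / 2) * \<kappa>)\<^sup>2"
  proof -
    have "real n - 1 = real m + 1" "real n = real m + 2" by (auto simp: m)
    then have "4 \<le> 2 ^ Suc m * \<kappa>\<^sup>2"
      using unit_ball_vol_ratio_ge[of m] unfolding \<kappa>_def by (simp only:)
    moreover have "(2 powr (d / 2))\<^sup>2 = (2::real) ^ Suc m"
      by (simp add: power2_eq_square powr_add[symmetric] d(2) powr_realpow[symmetric] del: power_Suc)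
    ultimately show ?thesis by (simp add: power_mult_distrib)
  qed
  then have "2 \<le> 2 powr (d / 2) * \<kappa>"
    by (rule power2_le_imp_le) (use \<kappa>0 in simp)
  then have "real n * 2 \<le> real n * (2 powr (d / 2) * \<kappa>)"
    by (intro mult_left_mono) auto
  \<comment> \<open>Under the power 2 / d the factor \<open>2 powr (d / 2)\<close> becomes 2, the
    quotient of 16 and 8.\<close>
  then have "(2 * real n) powr (2 / d) \<le> (2 powr (d / 2) * (real n * \<kappa>)) powr (2 / d)"
    using d(1) by (intro powr_mono2) (simp_all add: mult.left_commute mult.commute)
  also have "\<dots> = 2 * (real n * \<kappa>) powr (2 / d)"
  proof -
    have "(2 powr (d / 2)) powr (2 / d) = (2::real)"
      using d(1) by (simp add: powr_powr)
    then show ?thesis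
      using \<kappa>0 by (subst powr_mult) simp_all
  qed
  finally show ?thesis
    by (simp add: \<kappa>_def d_def)
qed

section \<open>Spectral bounds\<close>

lemma loewner_mat_le_form:
  fixes N :: "real^'q::finite^'q"
  assumes "loewner_le (mat m) N"
  shows "m * (norm x)\<^sup>2 \<le> x \<bullet> (N *v x)"
proof -
  have "mat m *v x = m *\<^sub>R x"
    by (simp add: vec_eq_iff matrix_vector_mult_def mat_def if_distrib[of "\<lambda>a. a * _"] cong: if_cong)
  moreover have "0 \<le> x \<bullet> ((N - mat m) *v x)"
    using assms by (simp add: loewner_le_def)
  ultimately show ?thesis
    by (simp add: matrix_vector_mult_diff_rdistrib inner_diff_right power2_norm_eq_inner)
qed

lemma loewner_form_le_mat:
  fixes N :: "real^'q::finite^'q"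
  assumes "loewner_le N (mat M)"
  shows "x \<bullet> (N *v x) \<le> M * (norm x)\<^sup>2"
proof -
  have "mat M *v x = M *\<^sub>R x"
    by (simp add: vec_eq_iff matrix_vector_mult_def mat_def if_distrib[of "\<lambda>a. a * _"] cong: if_cong)
  moreover have "0 \<le> x \<bullet> ((mat M - N) *v x)"
    using assms by (simp add: loewner_le_def)
  ultimately show ?thesis
    by (simp add: matrix_vector_mult_diff_rdistrib inner_diff_right power2_norm_eq_inner)
qed

lemma symmetric_form_commute:
  fixes N :: "real^'q::finite^'q"
  assumes "transpose N = N"
  shows "x \<bullet> (N *v y) = (N *v x) \<bullet> y"
  using dot_lmul_matrix[of x "transpose N" y] vector_transpose_matrix[of x N] assms by simp

lemma symmetric_form_add:
  fixes N :: "real^'q::finite^'q"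
  assumes "transpose N = N"
  shows "(x + t *\<^sub>R y) \<bullet> (N *v (x + t *\<^sub>R y))
    = x \<bullet> (N *v x) + 2 * t * ((N *v x) \<bullet> y) + t\<^sup>2 * (y \<bullet> (N *v y))"
proof -
  have "x \<bullet> (N *v y) = (N *v x) \<bullet> y" "y \<bullet> (N *v x) = (N *v x) \<bullet> y"
    by (rule symmetric_form_commute[OF assms]) (rule inner_commute)
  then show ?thesis
    by (simp add: matrix_vector_right_distrib matrix_vector_mult_scaleR inner_add_left
        inner_add_right power2_eq_square algebra_simps)
qed

text \<open>The positive form is evaluated at \<open>x - N x / M\<close>.\<close>

lemma norm_matrix_vector_sq_le_form:
  fixes N :: "real^'q::finite^'q"
  assumes sym: "transpose N = N" and psd: "\<And>x. 0 \<le> x \<bullet> (N *v x)"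
    and up: "loewner_le N (mat M)" and M: "0 < M"
  shows "(norm (N *v x))\<^sup>2 \<le> M * (x \<bullet> (N *v x))"
proof -
  let ?y = "N *v x"
  have "0 \<le> (x + (- 1 / M) *\<^sub>R ?y) \<bullet> (N *v (x + (- 1 / M) *\<^sub>R ?y))"
    by (rule psd)
  also have "\<dots> = x \<bullet> ?y - 2 / M * (norm ?y)\<^sup>2 + (1 / M)\<^sup>2 * (?y \<bullet> (N *v ?y))"
    unfolding symmetric_form_add[OF sym] by (simp add: power2_norm_eq_inner power_divide)
  also have "\<dots> \<le> x \<bullet> ?y - 2 / M * (norm ?y)\<^sup>2 + (1 / M)\<^sup>2 * (M * (norm ?y)\<^sup>2)"
    by (intro add_left_mono mult_left_mono loewner_form_le_mat up) auto
  also have "\<dots> = x \<bullet> ?y - (norm ?y)\<^sup>2 / M"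
    using M by (simp add: power2_eq_square)
  finally show ?thesis using M by (simp add: field_simps)
qed

lemma sqrt_mult_norm_le_norm_wrt:
  fixes N :: "real^'q::finite^'q"
  assumes "loewner_le (mat m) N" "0 \<le> m"
  shows "sqrt m * norm z \<le> norm_wrt N z"
proof -
  have "sqrt m * norm z = sqrt (m * (norm z)\<^sup>2)"
    by (simp add: real_sqrt_mult)
  also have "\<dots> \<le> norm_wrt N z"
    unfolding norm_wrt_def by (intro real_sqrt_le_mono loewner_mat_le_form assms)
  finally show ?thesis .
qed

text \<open>The form N z \<bullet> z is the squared N-norm, and norm (N z) is at most sqrt M times
  the N-norm. So the Euclidean depth of the cut loses only one root of M, and \<theta> is sqrt (m /
  M) instead of m / M.\<close>

lemma unit_normal_depth:
  fixes N :: "real^'q::finite^'q"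
  assumes sym: "transpose N = N" and lo: "loewner_le (mat m) N" and up: "loewner_le N (mat M)"
    and mM: "0 < m" "m \<le> M" and z: "z \<noteq> 0"
  shows "N *v z \<noteq> 0" "norm_wrt N z / sqrt M \<le> (N *v z) \<bullet> z / norm (N *v z)"
proof -
  have psd: "0 \<le> x \<bullet> (N *v x)" for x
    using loewner_mat_le_form[OF lo, of x] mM
    by (smt (verit) mult_nonneg_nonneg zero_le_power2)
  have pos: "0 < z \<bullet> (N *v z)"
    using loewner_mat_le_form[OF lo, of z] mM z
    by (smt (verit) mult_pos_pos zero_less_norm_iff zero_less_power)
  then show nz: "N *v z \<noteq> 0" by auto
  have "norm (N *v z) \<le> sqrt (M * (z \<bullet> (N *v z)))"
    using norm_matrix_vector_sq_le_form[OF sym psd up, of z] mM by (intro real_le_rsqrt) auto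
  also have "\<dots> = sqrt M * norm_wrt N z"
    by (simp add: norm_wrt_def real_sqrt_mult)
  finally have "norm_wrt N z * norm (N *v z) \<le> norm_wrt N z * (sqrt M * norm_wrt N z)"
    using psd by (intro mult_left_mono) (auto simp: norm_wrt_def)
  also have "\<dots> = sqrt M * ((N *v z) \<bullet> z)"
    using pos by (simp add: norm_wrt_def inner_commute)
  finally show "norm_wrt N z / sqrt M \<le> (N *v z) \<bullet> z / norm (N *v z)"
    using nz mM by (simp add: field_simps)
qed

section \<open>Scalarizations\<close>

text \<open>Substituting a = v + z leaves x as a mere witness of membership, so the scalarization
  becomes the projection of v onto A in the N-norm.\<close>

lemma feasible_P_iff:
  "(\<exists>x. feasible_P \<Gamma> X C w \<gamma> v (x, z)) \<longleftrightarrow> v + z \<in> (\<Gamma> ` X + C) \<inter> halfspace_S w \<gamma>"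
proof -
  have "v + z \<in> \<Gamma> ` X + C \<longleftrightarrow> (\<exists>x\<in>X. v + z - \<Gamma> x \<in> C)"
  proof
    assume "v + z \<in> \<Gamma> ` X + C"
    then obtain x b where "v + z = \<Gamma> x + b" "x \<in> X" "b \<in> C" by (auto elim!: set_plus_elim)
    then show "\<exists>x\<in>X. v + z - \<Gamma> x \<in> C" by (intro bexI[of _ x]) auto
  next
    assume "\<exists>x\<in>X. v + z - \<Gamma> x \<in> C"
    then obtain x where "x \<in> X" "v + z - \<Gamma> x \<in> C" by blast
    then have "\<Gamma> x + (v + z - \<Gamma> x) \<in> \<Gamma> ` X + C" by (intro set_plus_intro) auto
    then show "v + z \<in> \<Gamma> ` X + C" by simp
  qed
  moreover have "0 - (\<Gamma> x - z - v) = v + z - \<Gamma> x" for x by (simp add: algebra_simps)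
  ultimately show ?thesis
    unfolding feasible_P_def cone_le_def halfspace_S_def prod.case Int_iff mem_Collect_eq
    by (simp only: Bex_def) blast
qed

lemma optimal_P_nearest:
  assumes "optimal_P \<Gamma> X C w \<gamma> N v (x, z)"
  defines "A \<equiv> (\<Gamma> ` X + C) \<inter> halfspace_S w \<gamma>"
  shows "v + z \<in> A" "\<And>a. a \<in> A \<Longrightarrow> norm_wrt N z \<le> norm_wrt N (a - v)"
proof -
  have opt: "feasible_P \<Gamma> X C w \<gamma> v (x, z)"
    "\<And>x' z'. feasible_P \<Gamma> X C w \<gamma> v (x', z') \<Longrightarrow> \<not> norm_wrt N z' < norm_wrt N z"
    using assms(1) unfolding optimal_P_def is_arg_min_def by auto
  show "v + z \<in> A"
    unfolding A_def using opt(1) feasible_P_iff by blast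
  fix a assume "a \<in> A"
  then have "v + (a - v) \<in> A" by simp
  then obtain x' where "feasible_P \<Gamma> X C w \<gamma> v (x', a - v)"
    unfolding A_def feasible_P_iff[symmetric] by blast
  then show "norm_wrt N z \<le> norm_wrt N (a - v)" using opt(2) by fastforce
qed

text \<open>Otherwise a short step from v + z towards a would decrease the N-norm: its square
  changes by t * (t * Q - 2 * b).\<close>

lemma nearest_point_supporting:
  fixes N :: "real^'q::finite^'q"
  assumes sym: "transpose N = N" and psd: "\<And>x. 0 \<le> x \<bullet> (N *v x)"
    and A: "convex A" "v + z \<in> A" "a \<in> A"
    and nearest: "\<And>a. a \<in> A \<Longrightarrow> norm_wrt N z \<le> norm_wrt N (a - v)"
  shows "0 \<le> (N *v z) \<bullet> (a - (v + z))"
proof (rule ccontr)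
  define h where "h = a - (v + z)"
  define b where "b = - ((N *v z) \<bullet> h)"
  define Q where "Q = h \<bullet> (N *v h)"
  assume "\<not> 0 \<le> (N *v z) \<bullet> (a - (v + z))"
  then have b: "0 < b" by (simp add: b_def h_def)
  have Q: "0 \<le> Q" by (simp add: Q_def psd)
  \<comment> \<open>The bound 1 keeps the moved point on the segment inside A; the other gives t * Q
    \<le> b, also when Q = 0.\<close>
  define t where "t = min 1 (b / (Q + 1))"
  have t: "0 < t" "t \<le> 1" using b Q by (auto simp: t_def)
  have "t * Q \<le> b / (Q + 1) * Q" using Q by (intro mult_right_mono) (auto simp: t_def)
  also have "\<dots> \<le> b" using b Q by (simp add: field_simps)
  finally have tQ: "t * Q \<le> b" .
  have "(1 - t) *\<^sub>R (v + z) + t *\<^sub>R a \<in> A"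
    using A t by (intro convexD) auto
  also have "(1 - t) *\<^sub>R (v + z) + t *\<^sub>R a = v + (z + t *\<^sub>R h)"
    by (simp add: h_def algebra_simps)
  finally have "norm_wrt N z \<le> norm_wrt N (z + t *\<^sub>R h)"
    using nearest[of "v + (z + t *\<^sub>R h)"] by simp
  then have "z \<bullet> (N *v z) \<le> (z + t *\<^sub>R h) \<bullet> (N *v (z + t *\<^sub>R h))"
    by (simp add: norm_wrt_def)
  also have "\<dots> = z \<bullet> (N *v z) + t * (t * Q - 2 * b)"
    unfolding symmetric_form_add[OF sym] by (simp add: b_def Q_def algebra_simps power2_eq_square)
  finally have "0 \<le> t * (t * Q - 2 * b)" by simp
  then have "0 \<le> t * Q - 2 * b" using t by (simp add: zero_le_mult_iff)
  then show False using tQ b by simp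
qed

section \<open>Hausdorff distance and circumradius\<close>

text \<open>Points of T have distance 0 to S, so the second supremum vanishes and the maximum is
  decided by the first.\<close>

lemma hausdorff_dist_superset:
  assumes "T \<subseteq> S" "T \<noteq> {}"
  shows "0 \<le> hausdorff_dist S T"
    and "(\<And>x. x \<in> S \<Longrightarrow> infdist x T \<le> D) \<Longrightarrow> hausdorff_dist S T \<le> D"
proof -
  have "(SUP y\<in>T. infdist y S) = (SUP y\<in>T. 0)"
    using assms by (intro SUP_cong) auto
  then have 0: "(SUP y\<in>T. infdist y S) = 0" using assms by simp
  then show "0 \<le> hausdorff_dist S T" by (simp add: hausdorff_dist_def)
  assume D: "\<And>x. x \<in> S \<Longrightarrow> infdist x T \<le> D"
  obtain x where "x \<in> S" using assms by blast
  then have "0 \<le> D" using D[of x] infdist_nonneg[of x T] by linarith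
  moreover have "(SUP x\<in>S. infdist x T) \<le> D"
    using \<open>x \<in> S\<close> by (intro cSUP_least D) auto
  ultimately show "hausdorff_dist S T \<le> D"
    by (simp add: hausdorff_dist_def 0)
qed

text \<open>The sum of T and a ball of radius D is convex, so it contains the hull once it contains
  V.\<close>

lemma infdist_convex_hull_le:
  fixes T :: "'a::real_normed_vector set"
  assumes T: "convex T" and V: "\<And>u. u \<in> V \<Longrightarrow> \<exists>a\<in>T. dist u a \<le> D"
    and x: "x \<in> convex hull V"
  shows "infdist x T \<le> D"
proof -
  have conv: "convex (\<Union>a\<in>T. \<Union>b\<in>cball 0 D. {a + b})"
    using convex_sums[OF T convex_cball] by blast
  have "V \<subseteq> (\<Union>a\<in>T. \<Union>b\<in>cball 0 D. {a + b})"
  proof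
    fix u assume "u \<in> V"
    then obtain a where a: "a \<in> T" "dist u a \<le> D" using V by blast
    then have "u = a + (u - a)" "u - a \<in> cball 0 D"
      by (auto simp: dist_norm norm_minus_commute)
    with a show "u \<in> (\<Union>a\<in>T. \<Union>b\<in>cball 0 D. {a + b})" by blast
  qed
  then have "x \<in> (\<Union>a\<in>T. \<Union>b\<in>cball 0 D. {a + b})"
    using x hull_minimal[of V] conv by blast
  then obtain a b where "a \<in> T" "norm b \<le> D" "x = a + b" by auto
  then show ?thesis by (intro infdist_le2[of a]) (auto simp: dist_norm)
qed

text \<open>Any radius above the infimum has an enclosing ball, so attainment of the infimum is
  never at issue; the slack is absorbed by \<epsilon>.\<close>

lemma subset_cball_circumradius_less:
  assumes "bounded S" "circumradius S < R"
  obtains c where "S \<subseteq> cball c R"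
proof -
  let ?Rs = "{r. 0 \<le> r \<and> (\<exists>c. S \<subseteq> cball c r)}"
  obtain c e where "S \<subseteq> cball c e"
    using assms(1) by (auto simp: bounded_subset_cball bounded_def subset_iff)
  moreover have "cball c e \<subseteq> cball c (max 0 e)" by (intro subset_cball) simp
  ultimately have "max 0 e \<in> ?Rs" by auto
  then have "?Rs \<noteq> {}" by blast
  from cInf_lessD[OF this] assms(2) obtain r where "r \<in> ?Rs" "r < R"
    unfolding circumradius_def by blast
  then obtain c' where "S \<subseteq> cball c' r" by blast
  then show ?thesis using that[of c'] subset_cball[of r R c'] \<open>r < R\<close> by force
qed

section \<open>Runs of the algorithm\<close>

locale metric_cutting_run =
  fixes C :: "(real^'q::finite) set" and X :: "(real^'n::finite) set"
    and \<Gamma> :: "real^'n \<Rightarrow> real^'q" and w :: "real^'q" and \<gamma> :: real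
    and A :: "(real^'q) set"
    and Ms :: "nat \<Rightarrow> real^'q^'q" and m M :: real
    and As :: "nat \<Rightarrow> (real^'q) set" and vs :: "nat \<Rightarrow> real^'q"
    and zs :: "nat \<Rightarrow> real^'q \<Rightarrow> real^'q"
  assumes A_eq: "A = (\<Gamma> ` X + C) \<inter> halfspace_S w \<gamma>"
    and A: "A \<noteq> {}" "convex A" "bounded A"
    and mM: "0 < m" "m \<le> M"
    and sym: "\<And>k. transpose (Ms k) = Ms k"
    and lo: "\<And>k. loewner_le (mat m) (Ms k)"
    and up: "\<And>k. loewner_le (Ms k) (mat M)"
    and run: "adaptive_metric_run \<Gamma> X C w \<gamma> Ms As vs zs"
begin

lemma psd: "0 \<le> x \<bullet> (Ms k *v x)"
  using loewner_mat_le_form[OF lo, of x k] mM by (smt (verit) mult_nonneg_nonneg zero_le_power2)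

lemma vertex_solution:
  assumes "reached vs zs k" "u extreme_point_of As k"
  shows "u + zs k u \<in> A"
    and "\<And>a. a \<in> A \<Longrightarrow> norm_wrt (Ms k) (zs k u) \<le> norm_wrt (Ms k) (a - u)"
    and "norm_wrt (Ms k) (zs k u) \<le> norm_wrt (Ms k) (zs k (vs k))"
proof -
  obtain x where "optimal_P \<Gamma> X C w \<gamma> (Ms k) u (x, zs k u)"
    using run assms unfolding adaptive_metric_run_def by blast
  note opt = optimal_P_nearest[OF this, folded A_eq]
  show "u + zs k u \<in> A"
    and "\<And>a. a \<in> A \<Longrightarrow> norm_wrt (Ms k) (zs k u) \<le> norm_wrt (Ms k) (a - u)"
    using opt by auto
  have "is_arg_max (\<lambda>u. norm_wrt (Ms k) (zs k u)) (\<lambda>u. u extreme_point_of As k) (vs k)"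
    using run assms(1) unfolding adaptive_metric_run_def by blast
  then show "norm_wrt (Ms k) (zs k u) \<le> norm_wrt (Ms k) (zs k (vs k))"
    using assms(2) by (auto simp: is_arg_max_def not_less)
qed

lemma selected_vertex:
  assumes "reached vs zs k"
  shows "vs k extreme_point_of As k"
  using run assms unfolding adaptive_metric_run_def is_arg_max_def by blast

lemma supporting:
  assumes "reached vs zs k" "a \<in> A"
  shows "0 \<le> (Ms k *v zs k (vs k)) \<bullet> (a - (vs k + zs k (vs k)))"
  using vertex_solution[OF assms(1) selected_vertex[OF assms(1)]] assms(2) A(2)
  by (intro nearest_point_supporting[OF sym psd]) auto

text \<open>Since m > 0, the normalising factor is positive and drops out; later arguments use N z
  directly.\<close>

lemma cut_halfspace_eq:
  assumes "zs k (vs k) \<noteq> 0"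
  shows "cut_halfspace (Ms k) (vs k) (zs k (vs k))
    = {y. 0 \<le> (Ms k *v zs k (vs k)) \<bullet> (y - (vs k + zs k (vs k)))}"
proof -
  have "0 < sqrt m * norm (zs k (vs k))" using assms mM by simp
  also have "\<dots> \<le> norm_wrt (Ms k) (zs k (vs k))"
    using mM by (intro sqrt_mult_norm_le_norm_wrt lo) auto
  finally show ?thesis
    unfolding cut_halfspace_def cut_normal_def
    by (auto simp: inner_diff_right divide_right_mono divide_le_cancel)
qed

lemma next_polytope:
  assumes "reached vs zs k" "zs k (vs k) \<noteq> 0"
  shows "As (Suc k) = As k \<inter> {y. 0 \<le> (Ms k *v zs k (vs k)) \<bullet> (y - (vs k + zs k (vs k)))}"
  using run assms cut_halfspace_eq unfolding adaptive_metric_run_def by simp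

text \<open>Each cut supports A and therefore keeps it. Compactness and convexity are there for
  Krein-Milman.\<close>

lemma invariant:
  assumes "reached vs zs k"
  shows "compact (As k) \<and> convex (As k) \<and> A \<subseteq> As k"
  using assms
proof (induction k)
  case 0
  then show ?case
    using run unfolding adaptive_metric_run_def A_eq[symmetric]
    by (auto simp: polytope_imp_compact polytope_imp_convex)
next
  case (Suc k)
  then have k: "reached vs zs k" "zs k (vs k) \<noteq> 0" by (auto simp: reached_def)
  have "{y. 0 \<le> (Ms k *v zs k (vs k)) \<bullet> (y - (vs k + zs k (vs k)))}
      = {y. (Ms k *v zs k (vs k)) \<bullet> y \<ge> (Ms k *v zs k (vs k)) \<bullet> (vs k + zs k (vs k))}"
    by (auto simp: inner_diff_right)
  then show ?case
    unfolding next_polytope[OF k] using Suc.IH[OF k(1)] supporting[OF k(1)]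
    by (auto simp: closed_halfspace_ge convex_halfspace_ge intro!: compact_Int_closed convex_Int)
qed

text \<open>By Krein-Milman it is enough to look at the vertices, where the farthest-vertex rule
  caps the metric norm and m converts it to Euclidean length.\<close>

lemma infdist_le_selected:
  assumes "reached vs zs k" "x \<in> As k"
  shows "infdist x A \<le> norm_wrt (Ms k) (zs k (vs k)) / sqrt m"
proof (rule infdist_convex_hull_le[OF A(2)])
  show "x \<in> convex hull {u. u extreme_point_of As k}"
    using Krein_Milman_Minkowski invariant assms by blast
  fix u assume "u \<in> {u. u extreme_point_of As k}"
  then have u: "u extreme_point_of As k" by simp
  have "sqrt m * norm (zs k u) \<le> norm_wrt (Ms k) (zs k u)"
    using mM by (intro sqrt_mult_norm_le_norm_wrt lo) auto
  also have "\<dots> \<le> norm_wrt (Ms k) (zs k (vs k))"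
    by (rule vertex_solution[OF assms(1) u])
  finally have "norm (zs k u) \<le> norm_wrt (Ms k) (zs k (vs k)) / sqrt m"
    using mM by (simp add: field_simps)
  then show "\<exists>a\<in>A. dist u a \<le> norm_wrt (Ms k) (zs k (vs k)) / sqrt m"
    using vertex_solution(1)[OF assms(1) u] by (intro bexI[of _ "u + zs k u"]) (auto simp: dist_norm)
qed

text \<open>The selected displacement is the largest, so when it vanishes every point of the
  polytope has distance 0 to the closed set A.\<close>

lemma terminates_exact:
  assumes "closed A" "terminates_at vs zs k"
  shows "As k = A"
proof
  have k: "reached vs zs k" "zs k (vs k) = 0"
    using assms(2) by (auto simp: terminates_at_def)
  show "A \<subseteq> As k" using invariant k by blast
  show "As k \<subseteq> A"
  proof
    fix x assume "x \<in> As k"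
    then have "infdist x A \<le> 0"
      using infdist_le_selected[OF k(1)] k(2) by (fastforce simp: norm_wrt_def)
    then show "x \<in> A"
      using in_closed_iff_infdist_zero[OF assms(1) A(1)] infdist_nonneg[of x A] by simp
  qed
qed

lemma reached_if_never_terminates:
  assumes "\<And>k. \<not> terminates_at vs zs k"
  shows "reached vs zs k"
proof (induction k)
  case (Suc k)
  then show ?case
    using assms[of k] by (auto simp: reached_def terminates_at_def less_Suc_eq)
qed (simp add: reached_def)

lemma rate:
  assumes dim: "CARD('q) \<ge> 2" and R: "A \<subseteq> cball c R" "0 < R"
    and run_on: "\<And>k. \<not> terminates_at vs zs k" and s: "0 < s" "s < 1"
  shows "\<exists>K. \<forall>k\<ge>K. hausdorff_dist (As k) A \<le> 8 * R * (1 + s)\<^sup>2 / (sqrt (m / M) * (1 - s)) *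
           (2 * real CARD('q) / real k) powr (2 / (real CARD('q) - 1))"
proof -
  define z where "z k = zs k (vs k)" for k
  define n where "n k = Ms k *v z k" for k
  \<comment> \<open>The vector \<open>n k\<close> points into the halfspace that contains A, hence
    the sign of the outward normal.\<close>
  define u where "u k = - ((1 / norm (n k)) *\<^sub>R n k)" for k
  have reach: "reached vs zs k" for k
    using reached_if_never_terminates run_on by blast
  have z0: "z k \<noteq> 0" for k
    using reach run_on[of k] by (auto simp: z_def terminates_at_def)
  have depth: "n k \<noteq> 0" "norm_wrt (Ms k) (z k) / sqrt M \<le> n k \<bullet> z k / norm (n k)" for k
    unfolding n_def using unit_normal_depth[OF sym[of k] lo[of k] up[of k] mM z0[of k]] by auto
  have n0: "0 < norm (n k)" for k using depth(1) by simp
  have u_inner: "u k \<bullet> x = - (n k \<bullet> x / norm (n k))" for k x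
    by (simp add: u_def)
  have u_le_0: "u k \<bullet> x \<le> 0 \<longleftrightarrow> 0 \<le> n k \<bullet> x" for k x
    using n0 by (simp add: u_inner zero_le_divide_iff)
  have deep: "norm_wrt (Ms k) (z k) / sqrt M \<le> u k \<bullet> (vs k - (vs k + z k))" for k
    using depth(2)[of k] by (simp add: u_inner)
  have \<theta>: "sqrt (m / M) * x = sqrt m * x / sqrt M" for x
    by (simp add: real_sqrt_divide)
  have anti: "As k \<subseteq> As i" if "i \<le> k" for i k
    using next_polytope[OF reach] z0 that
    by (intro lift_Suc_antimono_le[of As i k]) (auto simp: z_def)
  have E: "0 \<le> hausdorff_dist (As k) A" for k
    using invariant[OF reach] A by (intro hausdorff_dist_superset) auto
  \<comment> \<open>The polytopes shrink, so the largest metric distance at any earlier step i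
    bounds the Hausdorff distance at step k; this provides \<open>deep\<close> for all i \<le>
    k.\<close>
  have E_le: "hausdorff_dist (As k) A \<le> norm_wrt (Ms i) (z i) / sqrt m" if "i \<le> k" for i k
    unfolding z_def
    by (intro hausdorff_dist_superset infdist_le_selected reach)
       (use invariant[OF reach] A anti[OF that] in auto)
  have dimq: "DIM(real^'q) = CARD('q)" by simp
  show ?thesis
  proof (rule cutting_rate[where 'a="real^'q", unfolded dimq, OF dim R, of u "\<lambda>i. vs i + z i" vs])
    show "norm (u i) = 1" for i using n0[of i] by (simp add: u_def)
    show "vs i + z i \<in> A" for i
      unfolding z_def by (rule vertex_solution(1)[OF reach selected_vertex[OF reach]])
    show "u i \<bullet> (a - (vs i + z i)) \<le> 0" if "a \<in> A" for i a
      unfolding u_le_0 unfolding n_def z_def by (rule supporting[OF reach that])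
    show "u j \<bullet> (vs i - (vs j + z j)) \<le> 0" if "j < i" for i j
    proof -
      have "vs i \<in> As i" using selected_vertex[OF reach] by (simp add: extreme_point_of_def)
      \<comment> \<open>Cut j is built into \<open>As (Suc j)\<close>, and Suc j \<le> i.\<close>
      then have "vs i \<in> As (Suc j)" using anti[of "Suc j" i] that by auto
      then show ?thesis
        unfolding u_le_0 unfolding n_def z_def using next_polytope[OF reach] z0 by (auto simp: z_def)
    qed
    show "sqrt (m / M) * norm (vs i - (vs i + z i)) \<le> u i \<bullet> (vs i - (vs i + z i))" for i
    proof -
      have "sqrt m * norm (z i) / sqrt M \<le> norm_wrt (Ms i) (z i) / sqrt M"
        using mM by (intro divide_right_mono sqrt_mult_norm_le_norm_wrt lo) auto
      then show ?thesis using deep[of i] unfolding \<theta> by simp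
    qed
    show "sqrt (m / M) * hausdorff_dist (As k) A \<le> u i \<bullet> (vs i - (vs i + z i))"
      if "i \<le> k" for i k
    proof -
      have "sqrt m * hausdorff_dist (As k) A \<le> norm_wrt (Ms i) (z i)"
        using E_le[OF that] mM by (simp add: field_simps)
      then have "sqrt m * hausdorff_dist (As k) A / sqrt M \<le> norm_wrt (Ms i) (z i) / sqrt M"
        using mM by (intro divide_right_mono) auto
      then show ?thesis using deep[of i] unfolding \<theta> by simp
    qed
    show "0 < sqrt (m / M)" "sqrt (m / M) \<le> 1" using mM by auto
  qed (use E s in auto)
qed

end

section \<open>Termination or the asymptotic rate, by letting the slack s tend to 0\<close>

theorem theorem14:
  fixes C :: "(real^'q::finite) set" and X :: "(real^'n::finite) set"
    and \<Gamma> :: "real^'n \<Rightarrow> real^'q" and w :: "real^'q" and \<alpha> \<gamma> :: real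
    and A :: "(real^'q) set"
    and Ms :: "nat \<Rightarrow> real^'q^'q" and m M :: real
    and As :: "nat \<Rightarrow> (real^'q) set" and vs :: "nat \<Rightarrow> real^'q"
    and zs :: "nat \<Rightarrow> real^'q \<Rightarrow> real^'q"
  assumes q: "CARD('q) \<ge> 2"
    and C: "ordering_cone C"
    and X: "X \<noteq> {}" "compact X" "convex X" "interior X \<noteq> {}"
    and \<Gamma>: "continuous_on X \<Gamma>" "cone_convex_on C X \<Gamma>"
    and w: "w \<in> interior (dual_cone C)"
    and \<gamma>: "\<alpha> > 0" "\<gamma> = (SUP x\<in>X. w \<bullet> \<Gamma> x) + \<alpha>" "\<Gamma> ` X \<subseteq> interior (halfspace_S w \<gamma>)"
    and A_eq: "A = (\<Gamma> ` X + C) \<inter> halfspace_S w \<gamma>"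
    and A: "A \<noteq> {}" "convex A" "compact A" "circumradius A > 0"
    and mM: "0 < m" "m \<le> M"
    and Ms: "\<And>k. transpose (Ms k) = Ms k"
      "\<And>k. loewner_le (mat m) (Ms k)" "\<And>k. loewner_le (Ms k) (mat M)"
    and run: "adaptive_metric_run \<Gamma> X C w \<gamma> Ms As vs zs"
    and exact: "\<And>k u. reached vs zs k \<Longrightarrow> u extreme_point_of As k \<Longrightarrow>
                  norm_wrt (Ms k) (zs k u) = dist_wrt (Ms k) u A"
  shows "(\<exists>kbar. terminates_at vs zs kbar \<and> As kbar = A) \<or>
         (\<forall>k. \<not> terminates_at vs zs k) \<and>
         (\<forall>\<epsilon>>0. \<exists>K. \<forall>k\<ge>K.
            hausdorff_dist (As k) A \<le>
              (1 + \<epsilon>) * (1 / sqrt (m / M)) * lambda_bar A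
                * real k powr (2 / (1 - real CARD('q)))) \<and>
         (\<lambda>k. hausdorff_dist (As k) A) \<in> O(\<lambda>k. real k powr (2 / (1 - real CARD('q))))"
proof -
  note compact_A = \<open>compact A\<close> and circumradius_pos = \<open>circumradius A > 0\<close>
  interpret metric_cutting_run C X \<Gamma> w \<gamma> A Ms m M As vs zs
    by unfold_locales (use A_eq A mM Ms run compact_imp_bounded in auto)
  define \<theta> where "\<theta> = sqrt (m / M)"
  have \<theta>: "0 < \<theta>" using mM by (simp add: \<theta>_def)
  let ?q = "real CARD('q)"
  show ?thesis
  proof (cases "\<exists>k. terminates_at vs zs k")
    case True
    then show ?thesis using terminates_exact compact_imp_closed[OF compact_A] by blast
  next
    case False
    define R0 where "R0 = circumradius A"
    define \<beta> where "\<beta> = 2 / (?q - 1)"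
    have \<beta>: "2 / (1 - ?q) = - \<beta>"
      by (simp add: \<beta>_def minus_divide_right)
    have R0: "0 < R0" using circumradius_pos by (simp add: R0_def)
    have lambda: "R0 * (8 * (2 * ?q) powr \<beta>) \<le> lambda_bar A"
    proof -
      have "R0 * (8 * (2 * ?q) powr \<beta>)
          \<le> R0 * (16 * (?q * unit_ball_vol ?q / unit_ball_vol (?q - 1)) powr \<beta>)"
        unfolding \<beta>_def using R0 q by (intro mult_left_mono packing_constant_le) auto
      then show ?thesis by (simp add: lambda_bar_def R0_def \<beta>_def mult_ac)
    qed
    then have lambda0: "0 \<le> lambda_bar A"
      using R0 by (smt (verit) mult_nonneg_nonneg powr_ge_zero)
    have main: "\<exists>K. \<forall>k\<ge>K. hausdorff_dist (As k) A
        \<le> (1 + \<epsilon>) * (1 / \<theta>) * lambda_bar A * real k powr (2 / (1 - ?q))"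
      if \<epsilon>: "0 < \<epsilon>" for \<epsilon>
    proof -
      \<comment> \<open>\<open>rate\<close> contributes (1 + s)^2 / (1 - s), and the enclosing ball
        of radius (1 + s) * R0 a third factor 1 + s.\<close>
      have "((\<lambda>s::real. (1 + s) ^ 3 / (1 - s)) \<longlongrightarrow> (1 + 0) ^ 3 / (1 - 0)) (at_right 0)"
        by (intro tendsto_intros) auto
      then have "\<forall>\<^sub>F s::real in at_right 0. (1 + s) ^ 3 / (1 - s) < 1 + \<epsilon>"
        using \<epsilon> by (intro order_tendstoD) auto
      moreover have "\<forall>\<^sub>F s::real in at_right 0. s \<in> {0<..<1}"
        by (intro eventually_at_right_real) auto
      ultimately have "\<forall>\<^sub>F s::real in at_right 0. (1 + s) ^ 3 / (1 - s) < 1 + \<epsilon> \<and> s \<in> {0<..<1}"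
        by (rule eventually_conj)
      then obtain s :: real where s: "(1 + s) ^ 3 / (1 - s) < 1 + \<epsilon>" "0 < s" "s < 1"
        using eventually_happens'[OF trivial_limit_at_right_real] by fastforce
      have "circumradius A < (1 + s) * R0"
        using s R0 by (simp add: R0_def[symmetric])
      then obtain c where c: "A \<subseteq> cball c ((1 + s) * R0)"
        using subset_cball_circumradius_less[OF compact_imp_bounded[OF compact_A]] by blast
      obtain K where K: "\<And>k. k \<ge> K \<Longrightarrow> hausdorff_dist (As k) A
          \<le> 8 * ((1 + s) * R0) * (1 + s)\<^sup>2 / (\<theta> * (1 - s)) * (2 * ?q / real k) powr \<beta>"
        using rate[OF q c _ _ s(2,3)] False s R0 unfolding \<theta>_def \<beta>_def by auto
      have "hausdorff_dist (As k) A \<le> (1 + \<epsilon>) * (1 / \<theta>) * lambda_bar A * real k powr (2 / (1 - ?q))"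
        if "k \<ge> K" for k
      proof -
        have "hausdorff_dist (As k) A
            \<le> 8 * ((1 + s) * R0) * (1 + s)\<^sup>2 / (\<theta> * (1 - s)) * (2 * ?q / real k) powr \<beta>"
          by (rule K[OF that])
        also have "\<dots> = (1 + s) ^ 3 / (1 - s) * ((1 / \<theta>) * (R0 * (8 * (2 * ?q) powr \<beta>))
            * real k powr (- \<beta>))"
        proof -
          \<comment> \<open>At k = 0 both sides are 0, since division by 0 and \<open>0 powr\<close>
            yield 0.\<close>
          have "(2 * ?q / real k) powr \<beta> = (2 * ?q) powr \<beta> * real k powr (- \<beta>)"
            by (subst powr_divide) (simp_all add: powr_minus divide_inverse)
          then show ?thesis
            by (simp only: divide_inverse) (simp add: power3_eq_cube power2_eq_square mult_ac)
        qed
        also have "\<dots> \<le> (1 + \<epsilon>) * ((1 / \<theta>) * lambda_bar A * real k powr (- \<beta>))"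
          using s \<theta> lambda R0 \<epsilon>
          by (intro mult_mono mult_right_mono mult_left_mono) auto
        finally show ?thesis unfolding \<beta> by (simp only: mult_ac)
      qed
      then show ?thesis by blast
    qed
    \<comment> \<open>The instance \<epsilon> = 1 already gives the O-estimate.\<close>
    obtain K where K: "\<And>k. k \<ge> K \<Longrightarrow> hausdorff_dist (As k) A
        \<le> (1 + 1) * (1 / \<theta>) * lambda_bar A * real k powr (2 / (1 - ?q))"
      using main[of 1] by auto
    have E0: "0 \<le> hausdorff_dist (As k) A" for k
      using invariant reached_if_never_terminates False A
      by (intro hausdorff_dist_superset) blast+
    have "(\<lambda>k. hausdorff_dist (As k) A) \<in> O(\<lambda>k. real k powr (2 / (1 - ?q)))"
      by (rule bigoI[of _ "(1 + 1) * (1 / \<theta>) * lambda_bar A"], rule eventually_sequentiallyI[of K]) (use K E0 in auto)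
    then show ?thesis using main False unfolding \<theta>_def by blast
  qed
qed

end
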